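(* For any integer $t\ge 2$, there is a constant $C(t)$, depending only on $t$, such that ${\rm sat}^*\!\left(n,\left(\binom{2t}{t}+1\right)C_2\right)\le C(t)$ for all positive integers $n$.
   Context: For a poset $P=(P,\leqslant)$, a family $\mathcal{G}$ of sets is a (induced) copy of $P$ if there is a bijection $b:P\to\mathcal{G}$ such that $p\leqslant q$ if and only if $b(p)\subseteq b(q)$. A family $\mathcal{F}\subseteq 2^{[n]}$ is induced $P$-saturated if $\mathcal{F}$ contains no copy of $P$, but for every $G\in 2^{[n]}\setminus\mathcal{F}$ the family $\mathcal{F}\cup\{G\}$ contains a copy of $P$. ${\rm sat}^*(n,P)$ is the minimum size of an induced $P$-saturated family $\mathcal{F}\subseteq 2^{[n]}$. $C_2$ is the two-element chain and $mC_2$ denotes the disjoint union of $m$ pairwise incomparable copies of $C_2$. *)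

theory Defs
  imports Complex_Main
begin

text \<open>A poset is given by its carrier together with its (reflexive) order relation.\<close>

type_synonym 'a poset = "'a set \<times> 'a rel"

definition is_copy :: "'a poset \<Rightarrow> 'b set set \<Rightarrow> bool" where
  "is_copy P \<G> \<longleftrightarrow>
     (\<exists>b. bij_betw b (fst P) \<G> \<and>
          (\<forall>p\<in>fst P. \<forall>q\<in>fst P. (p, q) \<in> snd P \<longleftrightarrow> b p \<subseteq> b q))"

definition contains_copy :: "'a poset \<Rightarrow> 'b set set \<Rightarrow> bool" where
  "contains_copy P \<F> \<longleftrightarrow> (\<exists>\<G>\<subseteq>\<F>. is_copy P \<G>)"

definition induced_saturated :: "nat \<Rightarrow> 'a poset \<Rightarrow> nat set set \<Rightarrow> bool" where
  "induced_saturated n P \<F> \<longleftrightarrow>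
     \<F> \<subseteq> Pow {1..n} \<and> \<not> contains_copy P \<F> \<and>
     (\<forall>G\<in>Pow {1..n} - \<F>. contains_copy P (\<F> \<union> {G}))"

text \<open>The minimum exists for every nonempty poset, see \<open>sat_star_attained\<close> below.\<close>

definition sat_star :: "nat \<Rightarrow> 'a poset \<Rightarrow> nat" where
  "sat_star n P = (LEAST k. \<exists>\<F>. induced_saturated n P \<F> \<and> card \<F> = k)"

definition chain2 :: "nat poset" where
  "chain2 = ({0, 1}, {(0, 0), (0, 1), (1, 1)})"

definition disjoint_copies :: "nat \<Rightarrow> 'a poset \<Rightarrow> (nat \<times> 'a) poset" where
  "disjoint_copies m P =
     ({..<m} \<times> fst P, {((i, x), (j, y)) | i j x y. i < m \<and> i = j \<and> (x, y) \<in> snd P})"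

lemma partial_order_disjoint_copies_chain2:
  "partial_order_on (fst (disjoint_copies m chain2)) (snd (disjoint_copies m chain2))"
  unfolding partial_order_on_def preorder_on_def
proof (intro conjI)
  show "refl_on (fst (disjoint_copies m chain2)) (snd (disjoint_copies m chain2))"
    by (auto simp: refl_on_def disjoint_copies_def chain2_def)
  show "snd (disjoint_copies m chain2)
      \<subseteq> fst (disjoint_copies m chain2) \<times> fst (disjoint_copies m chain2)"
    by (auto simp: disjoint_copies_def chain2_def)
  show "trans (snd (disjoint_copies m chain2))"
    by (rule transI) (auto simp: disjoint_copies_def chain2_def)
  show "antisym (snd (disjoint_copies m chain2))"
    by (rule antisymI) (auto simp: disjoint_copies_def chain2_def)
qed

lemma induced_saturated_exists:
  assumes "fst P \<noteq> {}"
  shows "\<exists>\<F>. induced_saturated n P \<F>"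
proof -
  let ?S = "{\<F>. \<F> \<subseteq> Pow {1..n} \<and> \<not> contains_copy P \<F>}"
  have "finite ?S" by (rule finite_subset[of _ "Pow (Pow {1..n})"]) auto
  moreover have "{} \<in> ?S"
    using assms by (auto simp: contains_copy_def is_copy_def bij_betw_def)
  ultimately obtain M where M: "M \<in> ?S" "\<And>X. X \<in> ?S \<Longrightarrow> M \<subseteq> X \<Longrightarrow> M = X"
    using finite_has_maximal[of ?S] by (metis (no_types, lifting) empty_iff)
  have "induced_saturated n P M"
    unfolding induced_saturated_def
  proof (intro conjI ballI)
    fix G assume G: "G \<in> Pow {1..n} - M"
    show "contains_copy P (M \<union> {G})"
    proof (rule ccontr)
      assume "\<not> contains_copy P (M \<union> {G})"
      then have "M \<union> {G} \<in> ?S" using M(1) G by simp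
      then have "M = M \<union> {G}" by (rule M(2)) blast
      then show False using G by blast
    qed
  qed (use M in auto)
  then show ?thesis by blast
qed

lemma sat_star_attained:
  assumes "fst P \<noteq> {}"
  shows "\<exists>\<F>. induced_saturated n P \<F> \<and> card \<F> = sat_star n P"
  unfolding sat_star_def
  by (rule LeastI_ex) (use induced_saturated_exists[OF assms] in blast)

end

theory Submission
  imports Defs
begin

text \<open>
  The bound holds for every number \<open>m = K + 1 \<ge> 3\<close> of chains.  Split the ground set into
  \<open>V = {1..K}\<close>, two further points \<open>x = K + 1\<close>, \<open>d = K + 2\<close> and one large block \<open>B\<close>.  Consider the family \<open>F\<close> of
  the following sets (juxtaposition is union, \<open>y\<close> ranges over \<open>V\<close>, \<open>Z\<close> over the 2-subsets of \<open>V\<close>):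
  the \<^emph>\<open>diamonds\<close> \<open>y\<close>, \<open>yx\<close>, \<open>ydB\<close>, \<open>yxdB\<close>, and the antichain of \<open>dB\<close>, \<open>xB\<close>, \<open>xd\<close>, \<open>VB\<close>, \<open>Zx\<close>, \<open>Zd\<close>.

  Every comparable pair in \<open>F\<close> meets a diamond.  Two mutually incomparable pairs meeting the diamond
  of the same \<open>y\<close> must be \<open>yx \<subset> Zx\<close> and \<open>dB \<subset> ydB\<close>; then no pair can meet the diamond of the other
  point of \<open>Z\<close>, and this happens only once since \<open>dB\<close> is used up.  So there are at most \<open>K\<close>
  pairwise incomparable pairs.  On the other hand, every set that meets \<open>B\<close> without containing it
  creates \<open>K + 1\<close> such pairs.  Hence any maximal extension of \<open>F\<close> without a copy consists of sets
  that contain \<open>B\<close> or are disjoint from it, and there are only \<open>2 ^ (K + 3)\<close> of those.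
\<close>

section \<open>Copies of disjoint chains, and bounds from partial families\<close>

text \<open>Any inclusion between members of pairs \<open>i\<close> and \<open>j\<close> forces
  \<open>l i \<subseteq> u j\<close>, so excluding these cross inclusions already makes different
  pairs incomparable.\<close>

lemma contains_copy_disjoint_chains_iff:
  "contains_copy (disjoint_copies m chain2) F \<longleftrightarrow>
     (\<exists>l u. (\<forall>i<m. l i \<in> F \<and> u i \<in> F \<and> l i \<subset> u i) \<and>
            (\<forall>i<m. \<forall>j<m. i \<noteq> j \<longrightarrow> \<not> l i \<subseteq> u j))"
  (is "?L \<longleftrightarrow> ?R")
proof
  assume ?L
  then obtain \<G> b where G: "\<G> \<subseteq> F" "bij_betw b (fst (disjoint_copies m chain2)) \<G>"
    and b: "\<forall>p\<in>fst (disjoint_copies m chain2). \<forall>q\<in>fst (disjoint_copies m chain2).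
      (p, q) \<in> snd (disjoint_copies m chain2) \<longleftrightarrow> b p \<subseteq> b q"
    unfolding contains_copy_def is_copy_def by blast
  have carrier: "(i, p) \<in> fst (disjoint_copies m chain2) \<longleftrightarrow> i < m \<and> p \<in> {0, 1}" for i p
    by (auto simp: disjoint_copies_def chain2_def)
  have ord: "i = j \<and> (p, q) \<in> {(0, 0), (0, 1), (1, 1 :: nat)} \<longleftrightarrow> b (i, p) \<subseteq> b (j, q)"
    if "i < m" "j < m" "p \<in> {0, 1}" "q \<in> {0, 1}" for i j p q
  proof -
    have "((i, p), (j, q)) \<in> snd (disjoint_copies m chain2) \<longleftrightarrow> b (i, p) \<subseteq> b (j, q)"
      using b that carrier by blast
    then show ?thesis using that(1) by (auto simp: disjoint_copies_def chain2_def)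
  qed
  have mem: "b (i, p) \<in> F" if "i < m" "p \<in> {0, 1}" for i p
    using G carrier that bij_betwE by blast
  have "b (i, 0) \<subset> b (i, 1)" if "i < m" for i
    using ord[of i i 0 1] ord[of i i 1 0] that by auto
  moreover have "\<not> b (i, 0) \<subseteq> b (j, 1)" if "i < m" "j < m" "i \<noteq> j" for i j
    using ord[of i j 0 1] that by auto
  ultimately show ?R
    using mem by (intro exI[of _ "\<lambda>i. b (i, 0)"] exI[of _ "\<lambda>i. b (i, 1)"]) auto
next
  assume ?R
  then obtain l u where F: "\<And>i. i < m \<Longrightarrow> l i \<in> F \<and> u i \<in> F"
    and lu: "\<And>i. i < m \<Longrightarrow> l i \<subset> u i"
    and inc: "\<And>i j. \<lbrakk>i < m; j < m; l i \<subseteq> u j\<rbrakk> \<Longrightarrow> i = j"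
    by metis
  define b where "b = (\<lambda>(i, p :: nat). if p = 0 then l i else u i)"
  let ?C = "{..<m} \<times> {0, 1 :: nat}"
  have ord: "i = j \<and> (p, q) \<in> {(0, 0), (0, 1), (1, 1)} \<longleftrightarrow> b (i, p) \<subseteq> b (j, q)"
    if "i < m" "j < m" "p \<in> {0, 1}" "q \<in> {0, 1}" for i j p q
  proof -
    have "i = j" if "b (i, p) \<subseteq> b (j, q)"
    proof -
      have "l i \<subseteq> b (i, p)" "b (j, q) \<subseteq> u j"
        using lu[OF \<open>i < m\<close>] lu[OF \<open>j < m\<close>] by (auto simp: b_def)
      then show ?thesis using inc that \<open>i < m\<close> \<open>j < m\<close> by blast
    qed
    then show ?thesis
      using that lu[OF \<open>i < m\<close>] by (auto simp: b_def split: if_splits)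
  qed
  have "inj_on b ?C"
  proof (rule inj_onI, clarify)
    fix i p j q
    assume "i < m" "j < m" "p \<in> {0, 1 :: nat}" "q \<in> {0, 1 :: nat}" "b (i, p) = b (j, q)"
    then show "i = j \<and> p = q" using ord[of i j p q] ord[of j i q p] by auto
  qed
  then have "is_copy (disjoint_copies m chain2) (b ` ?C)"
    unfolding is_copy_def
  proof (intro exI[of _ b] conjI ballI)
    have "fst (disjoint_copies m chain2) = ?C"
      by (simp add: disjoint_copies_def chain2_def)
    then show "bij_betw b (fst (disjoint_copies m chain2)) (b ` ?C)"
      using \<open>inj_on b ?C\<close> by (simp add: bij_betw_def)
  next
    fix v w
    assume "v \<in> fst (disjoint_copies m chain2)" "w \<in> fst (disjoint_copies m chain2)"
    then obtain i p j q where vw: "v = (i, p)" "w = (j, q)"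
      and "i < m" "j < m" "p \<in> {0, 1}" "q \<in> {0, 1}"
      by (auto simp: disjoint_copies_def chain2_def)
    then show "(v, w) \<in> snd (disjoint_copies m chain2) \<longleftrightarrow> b v \<subseteq> b w"
      using ord[of i j p q] by (simp add: disjoint_copies_def chain2_def eq_commute[of i j])
  qed
  moreover have "b ` ?C \<subseteq> F" using F by (auto simp: b_def)
  ultimately show ?L unfolding contains_copy_def by blast
qed

text \<open>A maximal copy-free extension of \<open>F0\<close> is saturated. It stays inside
  \<open>H\<close>, because a member outside \<open>H\<close> would create a copy together with
  \<open>F0\<close> alone.\<close>

lemma sat_star_le:
  assumes "F0 \<subseteq> Pow {1..n}" "\<not> contains_copy P F0"
    and "\<And>G. \<lbrakk>G \<subseteq> {1..n}; G \<notin> H\<rbrakk> \<Longrightarrow> contains_copy P (F0 \<union> {G})"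
    and "finite H"
  shows "sat_star n P \<le> card H"
proof -
  let ?S = "{F. F0 \<subseteq> F \<and> F \<subseteq> Pow {1..n} \<and> \<not> contains_copy P F}"
  have "finite ?S" by (rule finite_subset[of _ "Pow (Pow {1..n})"]) auto
  moreover have "F0 \<in> ?S" using assms by auto
  ultimately obtain F where F: "F \<in> ?S" "\<And>X. \<lbrakk>X \<in> ?S; F \<subseteq> X\<rbrakk> \<Longrightarrow> F = X"
    using finite_has_maximal[of ?S] by (metis (no_types, lifting) empty_iff)
  have mono: "contains_copy P \<A> \<Longrightarrow> \<A> \<subseteq> \<B> \<Longrightarrow> contains_copy P \<B>" for \<A> \<B> :: "nat set set"
    unfolding contains_copy_def by blast
  have "contains_copy P (F \<union> {G})" if G: "G \<in> Pow {1..n} - F" for G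
  proof (rule ccontr)
    assume "\<not> contains_copy P (F \<union> {G})"
    then have "F = F \<union> {G}" using F(1) G by (intro F(2)) auto
    then show False using G by blast
  qed
  then have "induced_saturated n P F"
    unfolding induced_saturated_def using F(1) by blast
  then have "sat_star n P \<le> card F"
    unfolding sat_star_def by (intro Least_le) blast
  also have "F \<subseteq> H"
  proof
    fix G assume "G \<in> F"
    then have "\<not> contains_copy P (F0 \<union> {G})"
      using F(1) mono[of "F0 \<union> {G}" F] by blast
    then show "G \<in> H" using assms(3) F(1) \<open>G \<in> F\<close> by blast
  qed
  then have "card F \<le> card H" by (rule card_mono[OF assms(4)])
  finally show ?thesis .
qed

section \<open>The construction and its coordinates\<close>

locale diamond_family =
  fixes K n :: nat
  assumes K: "2 \<le> K" and n: "K + 3 \<le> n"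
begin

definition V :: "nat set" where "V = {1..K}"
definition B :: "nat set" where "B = {K + 3..n}"

text \<open>Coordinates of a set: its trace on \<open>V\<close>, membership of x and of d as
  booleans, its trace on \<open>B\<close>.\<close>

definition blk :: "nat set \<Rightarrow> bool \<Rightarrow> bool \<Rightarrow> nat set \<Rightarrow> nat set" where
  "blk X a b C = X \<union> (if a then {K + 1} else {}) \<union> (if b then {K + 2} else {}) \<union> C"

definition diamond :: "nat \<Rightarrow> nat set set" where
  "diamond y = {blk {y} False False {}, blk {y} True False {},
                blk {y} False True B, blk {y} True True B}"

definition rest :: "nat set set" where
  "rest = {blk {} False True B, blk {} True False B, blk {} True True {}, blk V False False B}
     \<union> {blk {y, z} True False {} | y z. y \<in> V \<and> z \<in> V \<and> y \<noteq> z}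
     \<union> {blk {y, z} False True {} | y z. y \<in> V \<and> z \<in> V \<and> y \<noteq> z}"

definition family :: "nat set set" where
  "family = (\<Union>y\<in>V. diamond y) \<union> rest"

text \<open>The four coordinates live on disjoint parts of the ground set. This turns the later
  checks on concrete sets into componentwise simplification.\<close>

lemma blk_subset_iff:
  assumes "X \<subseteq> V" "Y \<subseteq> V" "C \<subseteq> B" "D \<subseteq> B"
  shows "blk X a b C \<subseteq> blk Y a' b' D \<longleftrightarrow> X \<subseteq> Y \<and> (a \<longrightarrow> a') \<and> (b \<longrightarrow> b') \<and> C \<subseteq> D"
proof -
  have "K + 1 \<notin> V" "K + 2 \<notin> V" "K + 1 \<notin> B" "K + 2 \<notin> B" "V \<inter> B = {}"
    by (auto simp: V_def B_def)
  then show ?thesis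
    using assms unfolding blk_def by (cases a'; cases b'; cases a; cases b) (simp; blast)+
qed

lemma blk_eq_iff:
  assumes "X \<subseteq> V" "Y \<subseteq> V" "C \<subseteq> B" "D \<subseteq> B"
  shows "blk X a b C = blk Y a' b' D \<longleftrightarrow> X = Y \<and> a = a' \<and> b = b' \<and> C = D"
  using blk_subset_iff[OF assms, of a b a' b']
    blk_subset_iff[OF assms(2,1,4,3), of a' b' a b] by blast

lemma blk_psubset_iff:
  assumes "X \<subseteq> V" "Y \<subseteq> V" "C \<subseteq> B" "D \<subseteq> B"
  shows "blk X a b C \<subset> blk Y a' b' D \<longleftrightarrow>
    X \<subseteq> Y \<and> (a \<longrightarrow> a') \<and> (b \<longrightarrow> b') \<and> C \<subseteq> D \<and> \<not> (X = Y \<and> a = a' \<and> b = b' \<and> C = D)"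
  unfolding psubset_eq using blk_subset_iff[OF assms] blk_eq_iff[OF assms] by simp

lemmas blk_iffs = blk_subset_iff blk_eq_iff blk_psubset_iff

lemma B_nonempty [simp]: "B \<noteq> {}" "{} \<noteq> B"
  using n by (auto simp: B_def)

lemma V_not_small:
  fixes y :: nat
  shows "\<not> V \<subseteq> {y}" "V \<noteq> {}"
proof -
  have V: "1 \<in> V" "2 \<in> V" using K by (auto simp: V_def)
  then show "V \<noteq> {}" by blast
  have "V \<subseteq> {y} \<Longrightarrow> 1 = (2 :: nat)" using V by blast
  then show "\<not> V \<subseteq> {y}" by auto
qed

lemma obtain_other:
  obtains z where "z \<in> V" "z \<noteq> y"
  using V_not_small(1)[of y] by blast

lemma subset_eq_blk:
  assumes "G \<subseteq> {1..n}"
  shows "G = blk (G \<inter> V) (K + 1 \<in> G) (K + 2 \<in> G) (G \<inter> B)"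
proof -
  have "w \<in> V \<or> w = K + 1 \<or> w = K + 2 \<or> w \<in> B" if "w \<in> G" for w
    using assms that by (force simp: V_def B_def)
  then show ?thesis unfolding blk_def by auto
qed

lemma family_subset: "family \<subseteq> Pow {1..n}"
  using n by (auto simp: family_def diamond_def rest_def blk_def V_def B_def split: if_splits)

section \<open>Comparable pairs inside the family\<close>

lemma rest_antichain:
  assumes "W \<in> rest" "W' \<in> rest"
  shows "\<not> W \<subset> W'"
  \<comment> \<open>With the elementwise rules deleted, inclusions stay in the form that
    \<open>blk_iffs\<close> rewrites.\<close>
  using assms V_not_small unfolding rest_def
  by (auto simp: blk_iffs doubleton_eq_iff del: subsetI psubsetI psubsetE)

lemma pair_meets_diamond:
  assumes "l \<in> family" "u \<in> family" "l \<subset> u"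
  shows "\<exists>y\<in>V. l \<in> diamond y \<or> u \<in> diamond y"
  using assms rest_antichain unfolding family_def by blast

lemma above_lower_middle:
  assumes "y \<in> V" "W \<in> family" "blk {y} True False {} \<subset> W"
  shows "W = blk {y} True True B \<or> (\<exists>z\<in>V. z \<noteq> y \<and> W = blk {y, z} True False {})"
  using assms unfolding family_def rest_def diamond_def
  by (auto simp: blk_iffs doubleton_eq_iff del: subsetI psubsetI psubsetE)

lemma below_lower_middle:
  assumes "y \<in> V" "W \<in> family" "W \<subset> blk {y} True False {}"
  shows "W = blk {y} False False {}"
  using assms V_not_small unfolding family_def rest_def diamond_def
  by (auto simp: blk_iffs del: subsetI psubsetI psubsetE)

lemma above_upper_middle:
  assumes "y \<in> V" "W \<in> family" "blk {y} False True B \<subset> W"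
  shows "W = blk {y} True True B"
  using assms unfolding family_def rest_def diamond_def
  by (auto simp: blk_iffs del: subsetI psubsetI psubsetE)

lemma below_upper_middle:
  assumes "y \<in> V" "W \<in> family" "W \<subset> blk {y} False True B"
  shows "W = blk {y} False False {} \<or> W = blk {} False True B"
  using assms V_not_small unfolding family_def rest_def diamond_def
  by (auto simp: blk_iffs del: subsetI psubsetI psubsetE)

text \<open>Members of the two pairs lying in the diamond are incomparable, so they are its two
  middle sets. The bottom and top of the diamond are comparable to both, which leaves only
  neighbours in \<open>rest\<close>.\<close>

lemma two_pairs_same_diamond:
  assumes y: "y \<in> V"
    and F: "l \<in> family" "u \<in> family" "l' \<in> family" "u' \<in> family"
    and lu: "l \<subset> u" "l' \<subset> u'" and inc: "\<not> l \<subseteq> u'" "\<not> l' \<subseteq> u"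
    and meets: "l \<in> diamond y \<or> u \<in> diamond y" "l' \<in> diamond y \<or> u' \<in> diamond y"
  shows "(\<exists>z\<in>V. z \<noteq> y \<and> u = blk {y, z} True False {} \<and> l' = blk {} False True B) \<or>
         (\<exists>z\<in>V. z \<noteq> y \<and> u' = blk {y, z} True False {} \<and> l = blk {} False True B)"
proof -
  \<comment> \<open>Stated for arbitrary pairs, since either one may hold the middle set
    \<open>yx\<close>.\<close>
  have key: "(\<exists>z\<in>V. z \<noteq> y \<and> u = blk {y, z} True False {}) \<and> l' = blk {} False True B"
    if F: "l \<in> family" "u \<in> family" "l' \<in> family" "u' \<in> family"
      and lu: "l \<subset> u" "l' \<subset> u'" and inc: "\<not> l \<subseteq> u'" "\<not> l' \<subseteq> u"
      and e: "blk {y} True False {} \<in> {l, u}" and e': "blk {y} False True B \<in> {l', u'}"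
    for l u l' u'
  proof
    have sub: "blk {y} False False {} \<subseteq> blk {y} True False {}"
      "blk {y} False False {} \<subseteq> blk {y} False True B"
      "blk {y} True False {} \<subseteq> blk {y} True True B"
      "blk {y} False True B \<subseteq> blk {y} True True B"
      using y by (auto simp: blk_iffs del: subsetI psubsetI psubsetE)
    have "l = blk {y} True False {}"
    proof (rule ccontr)
      assume "l \<noteq> blk {y} True False {}"
      then have "l = blk {y} False False {}" using e below_lower_middle[OF y F(1)] lu by auto
      then show False using sub e' lu inc by auto
    qed
    then show "\<exists>z\<in>V. z \<noteq> y \<and> u = blk {y, z} True False {}"
      using above_lower_middle[OF y F(2)] lu sub e' inc by auto
    have "u' = blk {y} False True B"
    proof (rule ccontr)
      assume "u' \<noteq> blk {y} False True B"
      then have "u' = blk {y} True True B" using e' above_upper_middle[OF y F(4)] lu by auto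
      then show False using sub e lu inc by auto
    qed
    then show "l' = blk {} False True B"
      using below_upper_middle[OF y F(3)] lu sub e inc by auto
  qed
  obtain e e' where e: "e \<in> {l, u}" "e \<in> diamond y" and e': "e' \<in> {l', u'}" "e' \<in> diamond y"
    using meets by auto
  have "\<not> e \<subseteq> e'" "\<not> e' \<subseteq> e" using e(1) e'(1) lu inc by auto
  then have "e = blk {y} True False {} \<and> e' = blk {y} False True B \<or>
             e' = blk {y} True False {} \<and> e = blk {y} False True B"
    using e(2) e'(2) y by (auto simp: diamond_def blk_iffs del: subsetI psubsetI psubsetE)
  then show ?thesis
    using key[OF F(1,2,3,4) lu inc] key[OF F(3,4,1,2) lu(2,1) inc(2,1)] e(1) e'(1) by metis
qed

text \<open>Pigeonhole applied twice to the map \<open>f\<close> sending each pair to a diamond it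
  meets: the first collision excludes a point \<open>z\<close> of \<open>V\<close>, and this forces
  a second one.\<close>

lemma family_no_copy: "\<not> contains_copy (disjoint_copies (K + 1) chain2) family"
proof
  assume "contains_copy (disjoint_copies (K + 1) chain2) family"
  then obtain l u where
    pairs: "\<forall>i<K + 1. l i \<in> family \<and> u i \<in> family \<and> l i \<subset> u i"
    and incomp: "\<forall>i<K + 1. \<forall>j<K + 1. i \<noteq> j \<longrightarrow> \<not> l i \<subseteq> u j"
    unfolding contains_copy_disjoint_chains_iff by blast
  have F: "l i \<in> family \<and> u i \<in> family" and lu: "l i \<subset> u i" if "i \<le> K" for i
    using pairs that by simp_all
  have inc: "\<not> l i \<subseteq> u j" if "i \<le> K" "j \<le> K" "i \<noteq> j" for i j
    using incomp that by simp
  have "\<exists>y. y \<in> V \<and> (l i \<in> diamond y \<or> u i \<in> diamond y)" if "i \<le> K" for i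
    using pair_meets_diamond[of "l i" "u i"] F[OF that] lu[OF that] by blast
  then obtain f where f: "\<And>i. i \<le> K \<Longrightarrow> f i \<in> V"
    "\<And>i. i \<le> K \<Longrightarrow> l i \<in> diamond (f i) \<or> u i \<in> diamond (f i)"
    by metis
  \<comment> \<open>The index set \<open>I\<close> is kept general for use before and after the
    removal of \<open>j\<close>.\<close>
  have clash: "\<exists>i\<in>I. \<exists>j\<in>I. i \<noteq> j \<and> l j = blk {} False True B \<and>
      (\<exists>z\<in>V. z \<noteq> f i \<and> u i = blk {f i, z} True False {} \<and> f j = f i)"
    if I: "I \<subseteq> {..K}" "\<not> inj_on f I" for I
  proof -
    obtain i j where ij: "i \<in> I" "j \<in> I" "i \<noteq> j" "f i = f j"
      using I(2) unfolding inj_on_def by auto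
    then have "i \<le> K" "j \<le> K" using I(1) by auto
    then have "(\<exists>z\<in>V. z \<noteq> f i \<and> u i = blk {f i, z} True False {} \<and> l j = blk {} False True B) \<or>
      (\<exists>z\<in>V. z \<noteq> f i \<and> u j = blk {f i, z} True False {} \<and> l i = blk {} False True B)"
      using f[of i] f[of j] F[of i] F[of j] lu[of i] lu[of j] inc[of i j] inc[of j i] ij(3,4)
      by (intro two_pairs_same_diamond) simp_all
    then show ?thesis using ij by metis
  qed
  have cV: "card V = K" "finite V" by (auto simp: V_def)
  have "\<not> inj_on f {..K}"
    using card_inj_on_le[of f "{..K}" V] f(1) cV by auto
  then obtain i j z where ij: "i \<le> K" "j \<le> K" "i \<noteq> j" "l j = blk {} False True B"
    and z: "z \<in> V" "z \<noteq> f i" "u i = blk {f i, z} True False {}" "f j = f i"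
    using clash[of "{..K}"] by auto
  have dead: "f k \<noteq> z" if k: "k \<le> K" for k
  proof
    assume fk: "f k = z"
    then have "k \<noteq> i" "k \<noteq> j" using z by auto
    obtain e where e: "e \<in> {l k, u k}" "e \<in> diamond z" using f(2)[OF k] fk by auto
    \<comment> \<open>The lower two sets of the diamond of \<open>z\<close> lie in
      \<open>u i\<close>, the upper two contain dB.\<close>
    have "e \<subseteq> u i \<or> l j \<subseteq> e"
      using e(2) z(1) f(1)[OF ij(1)] unfolding z(3) ij(4) diamond_def
      by (auto simp: blk_iffs del: subsetI psubsetI psubsetE)
    then have "l k \<subseteq> u i \<or> l j \<subseteq> u k" using e(1) lu[OF k] by auto
    then show False using inc k ij \<open>k \<noteq> i\<close> \<open>k \<noteq> j\<close> by blast
  qed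
  \<comment> \<open>\<open>K\<close> pairs remain for the \<open>K - 1\<close> points other than
    \<open>z\<close>.\<close>
  have "\<not> inj_on f ({..K} - {j})"
  proof
    assume "inj_on f ({..K} - {j})"
    then have "card ({..K} - {j}) \<le> card (V - {z})"
      using f(1) dead cV by (intro card_inj_on_le[of f]) auto
    then show False using cV z(1) ij(2) K by simp
  qed
  then obtain i' j' where "i' \<le> K" "j' \<le> K" "j' \<noteq> j" "l j' = blk {} False True B"
    using clash[of "{..K} - {j}"] by auto
  then have "l j \<subseteq> u j'" using lu[of j'] ij(4) by auto
  then show False using inc ij(2) \<open>j' \<le> K\<close> \<open>j' \<noteq> j\<close> by blast
qed

section \<open>Copies created by sets that split the block\<close>

text \<open>Indexing by \<open>insert 0 V\<close>, which is \<open>{0..K}\<close>, lets index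
  \<open>y\<close> in \<open>V\<close> serve the diamond of \<open>y\<close> and index 0 the one
  additional pair.\<close>

lemma copyI:
  assumes "\<And>i. i \<in> insert 0 V \<Longrightarrow> l i \<in> F \<and> u i \<in> F \<and> l i \<subset> u i"
    and "\<And>i j. \<lbrakk>i \<in> insert 0 V; j \<in> insert 0 V; i \<noteq> j\<rbrakk> \<Longrightarrow> \<not> l i \<subseteq> u j"
  shows "contains_copy (disjoint_copies (K + 1) chain2) F"
proof -
  have "i \<in> insert 0 V" if "i < K + 1" for i using that by (auto simp: V_def)
  then show ?thesis
    unfolding contains_copy_disjoint_chains_iff
    using assms by (intro exI[of _ l] exI[of _ u] conjI allI impI) simp_all
qed

lemma zero_notin_V [simp]: "0 \<notin> V"
  by (simp add: V_def)

text \<open>The lower edges \<open>y \<subset> yx\<close> of all diamonds form \<open>K\<close>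
  incomparable pairs, so one further pair \<open>g \<subset> h\<close> completes a copy.\<close>

lemma copy_from_lower_diamonds:
  assumes "g \<in> insert G family" "h \<in> insert G family" "g \<subset> h"
    and "\<And>y. y \<in> V \<Longrightarrow> \<not> blk {y} False False {} \<subseteq> h"
    and "\<And>y. y \<in> V \<Longrightarrow> \<not> g \<subseteq> blk {y} True False {}"
  shows "contains_copy (disjoint_copies (K + 1) chain2) (insert G family)"
  using assms
  by (intro copyI[of "\<lambda>i. if i = 0 then g else blk {i} False False {}"
        _ "\<lambda>i. if i = 0 then h else blk {i} True False {}"])
     (auto simp: blk_iffs family_def diamond_def del: subsetI psubsetI psubsetE)

text \<open>The same with the upper edges \<open>ydB \<subset> yxdB\<close>.\<close>

lemma copy_from_upper_diamonds:
  assumes "g \<in> insert G family" "h \<in> insert G family" "g \<subset> h"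
    and "\<And>y. y \<in> V \<Longrightarrow> \<not> blk {y} False True B \<subseteq> h"
    and "\<And>y. y \<in> V \<Longrightarrow> \<not> g \<subseteq> blk {y} True True B"
  shows "contains_copy (disjoint_copies (K + 1) chain2) (insert G family)"
  using assms
  by (intro copyI[of "\<lambda>i. if i = 0 then g else blk {i} False True B"
        _ "\<lambda>i. if i = 0 then h else blk {i} True True B"])
     (auto simp: blk_iffs family_def diamond_def del: subsetI psubsetI psubsetE)

text \<open>The trace \<open>X\<close> decides the edges used: lower ones if it is empty, upper ones
  if it has two points. The partner of \<open>G\<close> then comes from \<open>rest\<close>, and
  strictness from \<open>C\<close> being neither empty nor \<open>B\<close>.\<close>

lemma copy_if_splits_block:
  assumes "G \<subseteq> {1..n}" "G \<inter> B \<noteq> {}" "G \<inter> B \<noteq> B"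
  shows "contains_copy (disjoint_copies (K + 1) chain2) (insert G family)"
proof -
  define X a b C where defs: "X = G \<inter> V" "a = (K + 1 \<in> G)" "b = (K + 2 \<in> G)" "C = G \<inter> B"
  have G: "G = blk X a b C"
    unfolding defs using assms(1) by (rule subset_eq_blk)
  have XC [simp]: "X \<subseteq> V" "C \<subseteq> B" "C \<noteq> {}" "\<not> B \<subseteq> C" "C \<noteq> B" "\<not> C \<subseteq> {}"
    using assms(2,3) by (auto simp: defs)
  have VV [simp]: "\<And>y. y \<in> V \<Longrightarrow> V \<noteq> {y}" "\<And>y. y \<in> V \<Longrightarrow> \<not> V \<subseteq> {y}"
    using V_not_small by auto
  consider (empty) "X = {}" | (single) y where "X = {y}" "y \<in> V"
    | (big) y z where "y \<in> X" "z \<in> X" "y \<noteq> z"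
    using XC(1) by blast
  then show ?thesis
  proof cases
    case empty
    consider "\<not> a" | "a" "b" | "a" "\<not> b" by blast
    then show ?thesis
    proof cases
      case 1
      then show ?thesis using empty
        by (intro copy_from_lower_diamonds[of G _ "blk {} False True B"])
           (auto simp: G blk_iffs family_def rest_def del: subsetI psubsetI psubsetE)
    next
      case 2
      then show ?thesis using empty
        by (intro copy_from_lower_diamonds[of "blk {} True True {}" _ G])
           (auto simp: G blk_iffs family_def rest_def del: subsetI psubsetI psubsetE)
    next
      case 3
      then show ?thesis using empty
        by (intro copy_from_lower_diamonds[of G _ "blk {} True False B"])
           (auto simp: G blk_iffs family_def rest_def del: subsetI psubsetI psubsetE)
    qed
  next
    case single
    \<comment> \<open>If \<open>X = {y}\<close>, the diamond of \<open>y\<close> supplies two pairs: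
      one middle set is matched with \<open>G\<close>, the other with a member of
      \<open>rest\<close>.\<close>
    obtain z where z: "z \<in> V" "z \<noteq> y" by (rule obtain_other)
    show ?thesis
    proof (cases a)
      case False
      then show ?thesis using single z
        by (intro copyI[of
              "\<lambda>i. if i = 0 then G else if i = y then blk {y} True False {} else blk {i} False True B"
              _ "\<lambda>i. if i = 0 then blk {y} False True B
                  else if i = y then blk {y, z} True False {} else blk {i} True True B"])
           (auto simp: G blk_iffs family_def diamond_def rest_def del: subsetI psubsetI psubsetE)
    next
      case True
      then show ?thesis using single z
        by (intro copyI[of
              "\<lambda>i. if i = 0 then blk {y} True False {}
                  else if i = y then blk {} False True B else blk {i} False False {}"
              _ "\<lambda>i. if i = 0 then G else if i = y then blk {y} False True B else blk {i} True False {}"])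
           (auto simp: G blk_iffs family_def diamond_def rest_def del: subsetI psubsetI psubsetE)
    qed
  next
    case big
    then have yz: "y \<in> V" "z \<in> V" using XC(1) by blast+
    have X: "\<And>w. \<not> X \<subseteq> {w}" using big by auto
    consider "b" | "a" | "\<not> a" "\<not> b" by blast
    then show ?thesis
    proof cases
      case 1
      then show ?thesis using big yz
        by (intro copy_from_upper_diamonds[of "blk {y, z} False True {}" _ G])
           (auto simp: G blk_iffs family_def rest_def del: subsetI psubsetI psubsetE)
    next
      case 2
      then show ?thesis using big yz
        by (intro copy_from_upper_diamonds[of "blk {y, z} True False {}" _ G])
           (auto simp: G blk_iffs family_def rest_def del: subsetI psubsetI psubsetE)
    next
      case 3
      then show ?thesis using X
        by (intro copy_from_upper_diamonds[of G _ "blk V False False B"])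
           (auto simp: G blk_iffs family_def rest_def del: subsetI psubsetI psubsetE)
    qed
  qed
qed

section \<open>Counting, small ground sets and the conclusion\<close>

lemma sat_star_bound: "sat_star n (disjoint_copies (K + 1) chain2) \<le> 2 ^ (K + 3)"
proof -
  let ?A = "{1..K + 2}"
  define H where "H = Pow ?A \<union> (\<lambda>Y. Y \<union> B) ` Pow ?A"
  have "finite H" by (simp add: H_def)
  have "contains_copy (disjoint_copies (K + 1) chain2) (family \<union> {G})"
    if G: "G \<subseteq> {1..n}" "G \<notin> H" for G
  proof -
    have eq: "G = (G \<inter> ?A) \<union> (G \<inter> B)" using G(1) by (fastforce simp: B_def)
    have "G \<inter> B \<noteq> {}"
    proof
      assume "G \<inter> B = {}"
      then have "G \<in> Pow ?A" using eq by blast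
      then show False using G(2) unfolding H_def by blast
    qed
    moreover have "G \<inter> B \<noteq> B"
    proof
      assume "G \<inter> B = B"
      then have "G = (G \<inter> ?A) \<union> B" using eq by simp
      then show False using G(2) unfolding H_def by blast
    qed
    ultimately show ?thesis using copy_if_splits_block G(1) by simp
  qed
  then have "sat_star n (disjoint_copies (K + 1) chain2) \<le> card H"
    using sat_star_le[OF family_subset family_no_copy _ \<open>finite H\<close>] by blast
  also have "\<dots> \<le> card (Pow ?A) + card ((\<lambda>Y. Y \<union> B) ` Pow ?A)"
    unfolding H_def by (rule card_Un_le)
  also have "\<dots> \<le> card (Pow ?A) + card (Pow ?A)"
    by (intro add_left_mono card_image_le) simp
  also have "\<dots> = 2 ^ (K + 3)" by (simp add: card_Pow power_add)
  finally show ?thesis .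
qed

end

lemma sat_star_disjoint_chains_le:
  assumes "2 \<le> K"
  shows "sat_star n (disjoint_copies (K + 1) chain2) \<le> 2 ^ (K + 3)"
proof (cases "K + 3 \<le> n")
  case True
  then interpret diamond_family K n using assms by unfold_locales
  show ?thesis by (rule sat_star_bound)
next
  case False
  \<comment> \<open>For \<open>n \<le> K + 2\<close> the whole power set is small enough, so the
    empty family can be extended arbitrarily.\<close>
  have "\<not> contains_copy (disjoint_copies (K + 1) chain2) ({} :: nat set set)"
    unfolding contains_copy_disjoint_chains_iff by auto
  then have "sat_star n (disjoint_copies (K + 1) chain2) \<le> card (Pow {1..n})"
    by (intro sat_star_le[of "{}"]) auto
  also have "\<dots> \<le> 2 ^ (K + 3)"
    using False by (simp add: card_Pow)
  finally show ?thesis .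
qed

theorem theorem1p6:
  fixes t :: nat
  assumes "t \<ge> 2"
  shows "\<exists>C :: nat. \<forall>n :: nat. n \<ge> 1 \<longrightarrow>
           sat_star n (disjoint_copies (((2 * t) choose t) + 1) chain2) \<le> C"
proof -
  \<comment> \<open>Only a lower bound of 2 on the central binomial coefficient is required, to take
    it as \<open>K\<close>.\<close>
  have "(2 * t) choose 1 \<le> (2 * t) choose t"
    by (rule binomial_maximum')
  then have "2 \<le> (2 * t) choose t" using assms by simp
  then show ?thesis using sat_star_disjoint_chains_le by blast
qed

end
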